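(* Consider the event-triggered algorithm EF-HC described in the context, run over the physical network graphs $\mathcal{G}^{(k)}=(\mathcal{M},\mathcal{E}^{(k)})$, $k\ge 0$, with broadcast indicators $v_i^{(k)}\in\{0,1\}$ and information flow graphs $\mathcal{G}'^{(k)}=(\mathcal{M},\mathcal{E}'^{(k)})$. Assume: (a) there is an integer $B_1\ge 1$ such that for every $k\ge 0$ the union graph $\big(\mathcal{M},\bigcup_{s=0}^{B_1-1}\mathcal{E}^{(k+s)}\big)$ is connected; (b) there is an integer $B_2\ge 1$ such that for every device $i\in\mathcal{M}$ and every $k\ge 0$, $\max\{v_i^{(k)},v_i^{(k+1)},\dots,v_i^{(k+B_2-1)}\}=1$. Let $\tilde l\ge 0$ be the integer determined by $\tilde l B_1\le B_2\le(\tilde l+1)B_1-1$ and put $B=(\tilde l+2)B_1$. Then the information flow graph is $B$-connected, i.e. for every $k\ge 0$ the union graph $\mathcal{G}'^{(k:k+B-1)}=\big(\mathcal{M},\bigcup_{s=0}^{B-1}\mathcal{E}'^{(k+s)}\big)$ is connected.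
   Context: $\mathcal{M}=\{1,\dots,m\}$ is a set of devices. At each iteration $k=0,1,2,\dots$ there is an undirected physical network graph $\mathcal{G}^{(k)}=(\mathcal{M},\mathcal{E}^{(k)})$ (the available links), and $\mathcal{N}_i^{(k)}=\{j:(i,j)\in\mathcal{E}^{(k)}\}$. Algorithm EF-HC: each device $i$ holds a model $\mathbf{w}_i^{(k)}\in\mathbb{R}^n$ and an auxiliary model $\widehat{\mathbf{w}}_i^{(k)}\in\mathbb{R}^n$ (the last version of its model that it broadcast), with $\widehat{\mathbf{w}}_i^{(0)}=\mathbf{w}_i^{(0)}$. At iteration $k$ parameters are exchanged as follows. (Neighbor connection event) If device $j$ becomes connected to device $i$ at iteration $k$ (the link $(i,j)$ is in $\mathcal{E}^{(k)}$ and was not in $\mathcal{E}^{(k-1)}$), then $i$ and $j$ exchange their parameters over the link $(i,j)$ at iteration $k$. (Broadcast event) If $(1/n)^{1/2}\|\mathbf{w}_i^{(k)}-\widehat{\mathbf{w}}_i^{(k)}\|_2\ge r\rho_i\gamma^{(k)}$ (with given $r>0$, $\rho_i>0$, $\gamma^{(k)}>0$, $\lim_k\gamma^{(k)}=0$), then device $i$ exchanges parameters with all neighbors $j\in\mathcal{N}_i^{(k)}$ and sets $\widehat{\mathbf{w}}_i^{(k+1)}=\mathbf{w}_i^{(k)}$. The indicator $v_i^{(k)}$ equals $1$ if a broadcast event occurs at device $i$ at iteration $k$, and $0$ otherwise. After exchanges, devices average the received parameters with their own and take a local stochastic gradient step (these details do not affect which links are used beyond the indicators $v_i^{(k)}$).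 The information flow graph $\mathcal{G}'^{(k)}=(\mathcal{M},\mathcal{E}'^{(k)})$ is the subgraph of $\mathcal{G}^{(k)}$ whose edges are exactly the links of $\mathcal{E}^{(k)}$ used at iteration $k$ to exchange parameters, i.e. the links $(i,j)\in\mathcal{E}^{(k)}$ for which a neighbor connection event between $i$ and $j$ occurs at iteration $k$, or $v_i^{(k)}=1$, or $v_j^{(k)}=1$. *)

theory Defs
  imports "HOL-Analysis.Analysis" "Graph_Theory.Graph_Theory"
begin

text \<open>
  An undirected graph is given by a symmetric set of ordered pairs, so that \<open>(i, j)\<close> and
  \<open>(j, i)\<close> both stand for the link between \<open>i\<close> and \<open>j\<close>. Iterations and devices are
  indexed in the order \<open>w k i\<close>.
\<close>

definition network :: "nat \<Rightarrow> nat rel \<Rightarrow> nat pair_pre_digraph" where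
  "network m L = \<lparr>pverts = {1..m}, parcs = L\<rparr>"

text \<open>
  The name \<open>connected\<close> on its own is ambiguous between the topological and the graph-theoretic
  notion; the latter is meant.
\<close>

definition window_connected :: "nat \<Rightarrow> (nat \<Rightarrow> nat rel) \<Rightarrow> nat \<Rightarrow> bool" where
  "window_connected m E B \<longleftrightarrow>
     (\<forall>k. Digraph_Component.connected (with_proj (network m (\<Union>s\<in>{0..B - 1}. E (k + s)))))"

definition broadcast_event :: "real \<Rightarrow> real \<Rightarrow> real \<Rightarrow> real ^ 'n \<Rightarrow> real ^ 'n \<Rightarrow> bool" where
  "broadcast_event r \<rho>\<^sub>i \<gamma>\<^sub>k x x_hat \<longleftrightarrow> sqrt (1 / real CARD('n)) * norm (x - x_hat) \<ge> r * \<rho>\<^sub>i * \<gamma>\<^sub>k"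

text \<open>
  The model trajectory \<open>w\<close> is left arbitrary: the averaging and gradient steps that produce it
  affect the exchange of parameters only through the values \<open>w k i\<close>.
\<close>

primrec aux_model ::
  "real \<Rightarrow> (nat \<Rightarrow> real) \<Rightarrow> (nat \<Rightarrow> real) \<Rightarrow> (nat \<Rightarrow> nat \<Rightarrow> real ^ 'n) \<Rightarrow> nat \<Rightarrow> nat \<Rightarrow> real ^ 'n" where
  "aux_model r \<rho> \<gamma> w 0 i = w 0 i"
| "aux_model r \<rho> \<gamma> w (Suc k) i =
     (if broadcast_event r (\<rho> i) (\<gamma> k) (w k i) (aux_model r \<rho> \<gamma> w k i)
      then w k i else aux_model r \<rho> \<gamma> w k i)"

definition broadcast_indicator ::
  "real \<Rightarrow> (nat \<Rightarrow> real) \<Rightarrow> (nat \<Rightarrow> real) \<Rightarrow> (nat \<Rightarrow> nat \<Rightarrow> real ^ 'n) \<Rightarrow> nat \<Rightarrow> nat \<Rightarrow> nat" where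
  "broadcast_indicator r \<rho> \<gamma> w k i =
     (if broadcast_event r (\<rho> i) (\<gamma> k) (w k i) (aux_model r \<rho> \<gamma> w k i) then 1 else 0)"

text \<open>
  The extra argument \<open>E_init\<close> plays the role of the link set at iteration \<open>-1\<close>, which decides
  the neighbor connection events at iteration \<open>0\<close>: with the empty set every initial link is new,
  with \<open>E_init = E 0\<close> none is.
\<close>

definition neighbor_connection ::
  "nat rel \<Rightarrow> (nat \<Rightarrow> nat rel) \<Rightarrow> nat \<Rightarrow> nat \<Rightarrow> nat \<Rightarrow> bool" where
  "neighbor_connection E_init E k i j \<longleftrightarrow>
     (i, j) \<in> E k \<and> (i, j) \<notin> (case k of 0 \<Rightarrow> E_init | Suc k' \<Rightarrow> E k')"

definition flow_links ::
  "nat rel \<Rightarrow> (nat \<Rightarrow> nat rel) \<Rightarrow> (nat \<Rightarrow> nat \<Rightarrow> nat) \<Rightarrow> nat \<Rightarrow> nat rel" where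
  "flow_links E_init E v k =
     {(i, j) \<in> E k. neighbor_connection E_init E k i j \<or> v k i = 1 \<or> v k j = 1}"

end

theory Submission
  imports Defs
begin

text \<open>
  A link that is up in the last \<open>B1\<close> iterations of the window has either come up at some earlier
  iteration of the window, where the neighbor connection event uses it, or been up since the start
  of the window, that is for more than \<open>B2\<close> iterations, so that a broadcast of one of its
  endpoints uses it. Hence the flow links of the window contain all physical links of its last
  \<open>B1\<close> iterations, and these already connect the devices.
\<close>

lemma pair_wf_digraph_network_iff:
  "pair_wf_digraph (network m L) \<longleftrightarrow> L \<subseteq> {1..m} \<times> {1..m}"
  by (force simp: network_def pair_wf_digraph_def)

text \<open>Both networks have the vertex set \<open>{1..m}\<close>, so the one with fewer links is
  a spanning subgraph of the other; the bound on \<open>L'\<close> makes both well-formed.\<close>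

lemma connected_network_mono:
  assumes "Digraph_Component.connected (with_proj (network m L))"
    and "L \<subseteq> L'" and "L' \<subseteq> {1..m} \<times> {1..m}"
  shows "Digraph_Component.connected (with_proj (network m L'))"
proof -
  have wf: "wf_digraph (with_proj (network m L))" "wf_digraph (with_proj (network m L'))"
    using assms(2,3) by (simp_all add: wf_digraph_wp_iff pair_wf_digraph_network_iff)
  have "spanning (with_proj (network m L)) (with_proj (network m L'))"
    using wf assms(2) by (auto simp: spanning_def subgraph_def compatible_def network_def)
  then show ?thesis
    using assms(1) by (rule wf_digraph.connected_spanning_imp_connected[OF wf(2)])
qed

lemma flow_links_subset: "flow_links E_init E v k \<subseteq> E k"
  by (auto simp: flow_links_def)

text \<open>Induction on \<open>d\<close>: if the link is down at \<open>k + d\<close>, its presence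
  one step later is a connection event; otherwise the induction hypothesis applies.\<close>

lemma link_event_or_persistent:
  assumes "(i, j) \<in> E (k + d)"
  shows "(\<exists>s\<le>d. neighbor_connection E_init E (k + s) i j) \<or> (\<forall>s\<le>d. (i, j) \<in> E (k + s))"
  using assms
proof (induction d)
  case 0
  then show ?case by simp
next
  case (Suc d)
  show ?case
  proof (cases "(i, j) \<in> E (k + d)")
    case True
    then show ?thesis
      using Suc by (metis le_Suc_eq)
  next
    case False
    with Suc.prems have "neighbor_connection E_init E (k + Suc d) i j"
      by (simp add: neighbor_connection_def)
    then show ?thesis by blast
  qed
qed

text \<open>A connection event is itself a use of the link. If instead the link has persisted since
  \<open>k\<close>, it is up at \<open>k + t\<close>, where the broadcast of \<open>i\<close> uses
  it.\<close>

lemma link_used_in_window: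
  assumes link: "(i, j) \<in> E (k + d)"
    and broadcast: "v (k + t) i = 1" "t \<le> d"
  shows "\<exists>s\<le>d. (i, j) \<in> flow_links E_init E v (k + s)"
  using link_event_or_persistent[where E = E and E_init = E_init, OF link] broadcast
  by (force simp: flow_links_def neighbor_connection_def)

theorem mainTheorem1:
  fixes m B1 B2 l B :: nat
    and E_init :: "nat rel" and E :: "nat \<Rightarrow> nat rel"
    and w :: "nat \<Rightarrow> nat \<Rightarrow> real ^ 'n"
    and r :: real and \<rho> \<gamma> :: "nat \<Rightarrow> real"
    and v :: "nat \<Rightarrow> nat \<Rightarrow> nat"
  assumes graph_init: "pair_graph (network m E_init)"
    and graphs: "\<And>k. pair_graph (network m (E k))"
    and r_pos: "r > 0"
    and rho_pos: "\<And>i. i \<in> {1..m} \<Longrightarrow> \<rho> i > 0"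
    and gamma_pos: "\<And>k. \<gamma> k > 0"
    and gamma_lim: "\<gamma> \<longlonglongrightarrow> 0"
    and v_def: "v = broadcast_indicator r \<rho> \<gamma> w"
    and B1: "B1 \<ge> 1"
    and physical_connected: "window_connected m E B1"
    and B2: "B2 \<ge> 1"
    and broadcasts: "\<And>i k. i \<in> {1..m} \<Longrightarrow> Max ((\<lambda>s. v (k + s) i) ` {0..B2 - 1}) = 1"
    and l: "l * B1 \<le> B2" "B2 \<le> (l + 1) * B1 - 1"
    and B_def: "B = (l + 2) * B1"
  shows "window_connected m (flow_links E_init E v) B"
proof -
  have links: "E k \<subseteq> {1..m} \<times> {1..m}" for k
  proof -
    have "pair_wf_digraph (network m (E k))"
      using graphs[of k] by (simp add: pair_graph_def pair_digraph_def pair_fin_digraph_def)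
    then show ?thesis by (simp only: pair_wf_digraph_network_iff)
  qed
  have broadcast: "\<exists>t<B2. v (k + t) i = 1" if "i \<in> {1..m}" for i k
  proof -
    \<comment> \<open>The maximum is attained, so its value 1 yields an actual broadcast
      iteration.\<close>
    have "Max ((\<lambda>s. v (k + s) i) ` {0..B2 - 1}) \<in> (\<lambda>s. v (k + s) i) ` {0..B2 - 1}"
      by (rule Max_in) simp_all
    then have "1 \<in> (\<lambda>s. v (k + s) i) ` {0..B2 - 1}"
      by (simp only: broadcasts[OF that])
    then obtain t where "t \<le> B2 - 1" "v (k + t) i = 1" by auto
    with B2 show ?thesis by (intro exI[of _ t]) simp
  qed
  \<comment> \<open>Offset of the last \<open>B1\<close> iterations of the window. By
    \<open>l(2)\<close> it exceeds \<open>B2\<close>, so every device has broadcast before this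
    block begins.\<close>
  let ?d = "(l + 1) * B1"
  have B_eq: "B = ?d + B1"
    using B_def by (simp add: algebra_simps)
  show ?thesis
    unfolding window_connected_def
  proof
    fix k
    let ?L = "\<Union>s\<in>{0..B1 - 1}. E (k + ?d + s)"
    let ?L' = "\<Union>s\<in>{0..B - 1}. flow_links E_init E v (k + s)"
    have L_sub: "?L \<subseteq> ?L'"
    proof clarify
      fix i j s
      assume s: "s \<in> {0..B1 - 1}" and ij: "(i, j) \<in> E (k + ?d + s)"
      then have "i \<in> {1..m}" using links by blast
      then obtain t where t: "t < B2" "v (k + t) i = 1" using broadcast by blast
      from t(1) l(2) have "t \<le> ?d + s" by linarith
      moreover have "(i, j) \<in> E (k + (?d + s))"
        using ij by (simp only: add.assoc)
      ultimately have "\<exists>s'\<le>?d + s. (i, j) \<in> flow_links E_init E v (k + s')"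
        using t(2) by (intro link_used_in_window)
      then obtain s' where s': "s' \<le> ?d + s" "(i, j) \<in> flow_links E_init E v (k + s')"
        by blast
      \<comment> \<open>Since \<open>B1 \<ge> 1\<close>, the truncated subtractions are exact:
        \<open>s' \<le> ?d + (B1 - 1) = B - 1\<close>.\<close>
      have "s' \<le> B - 1"
        using s'(1) s B1 B_eq by (simp only: atLeastAtMost_iff) linarith
      with s'(2) show "(i, j) \<in> ?L'" by auto
    qed
    \<comment> \<open>The connectivity hypothesis is taken at the starting iteration
      \<open>k + ?d\<close>.\<close>
    have "Digraph_Component.connected (with_proj (network m ?L))"
      using physical_connected unfolding window_connected_def by blast
    moreover note L_sub
    moreover have "?L' \<subseteq> {1..m} \<times> {1..m}"
      using links flow_links_subset by blast
    ultimately show "Digraph_Component.connected (with_proj (network m ?L'))"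
      by (rule connected_network_mono)
  qed
qed

end
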